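(* Let $J\colon\mathbb{R}^2\to\mathbb{R}^2$ denote the rotation $J(u,v)=(-v,u)$, let $L>0$, and set $A=LJ$ and $B=LJ$ (skew-adjoint linear operators are maximally monotone). Then $B$ is monotone and $L$-Lipschitz, and $\operatorname{zer}(A+B)=\{0\}$. For every $\lambda\ge\frac{1}{2L}$ and generic initial data $(x_0,x_{-1})\in\mathbb{R}^2\times\mathbb{R}^2$, the sequences generated by the forward-reflected-backward (FRB) iteration $$x_{k+1}=J_{\lambda A}\bigl(x_k-2\lambda B(x_k)+\lambda B(x_{k-1})\bigr)$$ and by the reflected-forward-backward (RFB) iteration $$x_{k+1}=J_{\lambda A}\bigl(x_k-\lambda B(2x_k-x_{k-1})\bigr)$$ do not converge to the solution; for $\lambda>\frac{1}{2L}$ they diverge geometrically. Consequently $\frac{1}{2L}$ is the exact uniform step-size constant for the class: no larger constant can be certified for all maximally monotone $A$ and monotone $L$-Lipschitz $B$.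
   Context: For a maximally monotone operator $A\colon\mathcal H\rightrightarrows\mathcal H$ on a real Hilbert space $\mathcal H$ and $\lambda>0$, $J_{\lambda A}=(I+\lambda A)^{-1}$ is the resolvent (not to be confused with the rotation $J$), and $\operatorname{zer}(A+B)=\{x: 0\in Ax+Bx\}$. The class in question consists of the inclusions $0\in Ax+Bx$ with $A$ maximally monotone on a real Hilbert space $\mathcal H$, $B\colon\mathcal H\to\mathcal H$ monotone and $L$-Lipschitz, and $\operatorname{zer}(A+B)\neq\varnothing$; FRB and RFB are the two iterations displayed in the claim, with fixed step size $\lambda$. *)

theory Defs
  imports "HOL-Analysis.Analysis" "HOL-Library.Landau_Symbols" "HOL-Library.Set_Algebras"
begin

text \<open>
  Set-valued operators are functions into sets; a single-valued operator \<open>B\<close> is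
  used as \<open>\<lambda>x. {B x}\<close>, and sums of operators are pointwise Minkowski sums.
\<close>

definition monotone_op :: "('h::real_inner \<Rightarrow> 'h set) \<Rightarrow> bool" where
  "monotone_op A \<longleftrightarrow> (\<forall>x y. \<forall>u\<in>A x. \<forall>v\<in>A y. inner (x - y) (u - v) \<ge> 0)"

definition maximally_monotone :: "('h::real_inner \<Rightarrow> 'h set) \<Rightarrow> bool" where
  "maximally_monotone A \<longleftrightarrow>
     monotone_op A \<and> (\<forall>A'. monotone_op A' \<and> (\<forall>x. A x \<subseteq> A' x) \<longrightarrow> A' = A)"

definition zer :: "('h::real_vector \<Rightarrow> 'h set) \<Rightarrow> 'h set" where
  "zer T = {x. 0 \<in> T x}"

text \<open>
  The resolvent is the inverse of \<open>I + \<lambda>A\<close> as a set-valued operator. It is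
  single-valued with full domain when \<open>A\<close> is maximally monotone and \<open>\<lambda> > 0\<close>, so
  that \<open>p \<in> resolvent \<lambda> A z\<close> then means the usual equation for \<open>p\<close>.
\<close>

definition resolvent :: "real \<Rightarrow> ('h::real_vector \<Rightarrow> 'h set) \<Rightarrow> 'h \<Rightarrow> 'h set" where
  "resolvent lam A z = {p. \<exists>a\<in>A p. z = p + lam *\<^sub>R a}"

text \<open>
  Orbits are indexed with a shift by one: \<open>x 0\<close> is the iterate with index \<open>-1\<close> and
  \<open>x 1\<close> is the iterate with index \<open>0\<close>.
\<close>

definition frb ::
  "real \<Rightarrow> ('h::real_vector \<Rightarrow> 'h set) \<Rightarrow> ('h \<Rightarrow> 'h) \<Rightarrow> (nat \<Rightarrow> 'h) \<Rightarrow> bool" where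
  "frb lam A B x \<longleftrightarrow>
     (\<forall>k. x (k + 2) \<in> resolvent lam A
        (x (k + 1) - (2 * lam) *\<^sub>R B (x (k + 1)) + lam *\<^sub>R B (x k)))"

definition rfb ::
  "real \<Rightarrow> ('h::real_vector \<Rightarrow> 'h set) \<Rightarrow> ('h \<Rightarrow> 'h) \<Rightarrow> (nat \<Rightarrow> 'h) \<Rightarrow> bool" where
  "rfb lam A B x \<longleftrightarrow>
     (\<forall>k. x (k + 2) \<in> resolvent lam A
        (x (k + 1) - lam *\<^sub>R B (2 *\<^sub>R x (k + 1) - x k)))"

definition weakly_converges :: "(nat \<Rightarrow> 'h::real_inner) \<Rightarrow> 'h \<Rightarrow> bool" where
  "weakly_converges x l \<longleftrightarrow> (\<forall>y. (\<lambda>k. inner (x k) y) \<longlonglongrightarrow> inner l y)"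

text \<open>
  The constant \<open>c\<close> is certified on the Hilbert space \<open>'h\<close> for a method if every fixed
  step size in the open interval from \<open>0\<close> to \<open>c\<close> makes all orbits converge weakly to a
  solution, for every problem of the class with Lipschitz constant \<open>L\<close>.
\<close>

definition certified ::
  "'h::{real_inner,complete_space} itself \<Rightarrow>
   (real \<Rightarrow> ('h \<Rightarrow> 'h set) \<Rightarrow> ('h \<Rightarrow> 'h) \<Rightarrow> (nat \<Rightarrow> 'h) \<Rightarrow> bool) \<Rightarrow> real \<Rightarrow> real \<Rightarrow> bool" where
  "certified H iteration L c \<longleftrightarrow>
     (\<forall>lam A B x. 0 < lam \<and> lam < c \<and>
        maximally_monotone A \<and> monotone_op (\<lambda>x. {B x}) \<and> L-lipschitz_on UNIV B \<and>
        zer (\<lambda>x. A x + {B x}) \<noteq> {} \<and> iteration lam A B x \<longrightarrow>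
        (\<exists>l \<in> zer (\<lambda>x. A x + {B x}). weakly_converges x l))"

definition rot :: "real^2 \<Rightarrow> real^2" where
  "rot w = vector [- (w $ 2), w $ 1]"

text \<open>
  Generic means outside a proper linear subspace. In finite dimension such a subspace is
  closed, nowhere dense and Lebesgue null, so this entails both the topological and the
  measure-theoretic reading.
\<close>

definition generic :: "('a::euclidean_space \<Rightarrow> bool) \<Rightarrow> bool" where
  "generic P \<longleftrightarrow> (\<exists>S. subspace S \<and> S \<noteq> UNIV \<and> (\<forall>z. z \<notin> S \<longrightarrow> P z))"

definition diverges_geometrically :: "(nat \<Rightarrow> 'a::real_normed_vector) \<Rightarrow> bool" where
  "diverges_geometrically x \<longleftrightarrow>
     (\<exists>r::real. r > 1 \<and> (\<lambda>k. norm (x k)) \<in> \<Theta>(\<lambda>k. r ^ k))"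

end

theory Submission
  imports Defs
begin

text \<open>
  Convergence below \<open>1 / (2 L)\<close>: the forward-reflected-backward method has a Lyapunov function in
  the distance to a solution. For the reflected-forward-backward method the points
  \<open>y k = 2 x k - x (k - 1)\<close> at which \<open>B\<close> is evaluated satisfy the same recursion with
  \<open>2 a (k + 1) - a k\<close> in place of \<open>a (k + 1) \<in> A (x (k + 1))\<close>; monotonicity of \<open>A\<close>
  survives this reflection up to a telescoping term, so the same Lyapunov function works with a
  nonnegative potential added. In both cases the distances to all solutions converge and increments
  vanish, and Opial's lemma gives weak convergence.

  Sharpness: identify the plane with the complex numbers, so that the rotation becomes multiplication
  by \<open>\<i>\<close>. With \<open>t = \<lambda> L\<close>, both methods become
  \<open>(1 + \<i> t) z (k + 2) = (1 - 2 \<i> t) z (k + 1) + \<i> t z k\<close>, whose dominant characteristic root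
  has modulus \<open>1\<close> at \<open>t = 1/2\<close> and greater than \<open>1\<close> beyond. Data outside the
  eigenspace of the other root give orbits of exactly that growth.
\<close>

subsection \<open>Weak limits in Hilbert spaces\<close>

definition weak_limit :: "('i \<Rightarrow> 'h::real_inner) \<Rightarrow> 'h \<Rightarrow> 'i filter \<Rightarrow> bool" where
  "weak_limit x l F \<longleftrightarrow> (\<forall>v. ((\<lambda>k. inner (x k) v) \<longlongrightarrow> inner l v) F)"

lemma weak_limitD: "weak_limit x l F \<Longrightarrow> ((\<lambda>k. inner (x k) v) \<longlongrightarrow> inner l v) F"
  by (simp add: weak_limit_def)

text \<open>First-order optimality in scalar form: for small \<open>s\<close> the linear term
  dominates. The test value \<open>- a / (c + 1)\<close> is already small enough.\<close>

lemma quadratic_nonneg_imp_zero: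
  fixes a c :: real
  assumes "\<And>s. 2 * s * a + s\<^sup>2 * c \<ge> 0"
  shows "a = 0"
proof (rule ccontr)
  assume "a \<noteq> 0"
  have c: "c \<ge> 0"
    using assms[of 1] assms[of "-1"] by simp
  define k where "k = inverse (c + 1)"
  have k: "k > 0" and kc: "k * c = 1 - k"
    using c by (simp_all add: k_def field_simps)
  have "2 * (- a * k) * a + (- a * k)\<^sup>2 * c = a\<^sup>2 * k * (k * c - 2)"
    by (simp add: power2_eq_square algebra_simps)
  also have "\<dots> < 0"
    using \<open>a \<noteq> 0\<close> k by (intro mult_pos_neg) (auto simp: kc)
  finally show False
    using assms[of "- a * k"] by linarith
qed

text \<open>The representing vector minimises \<open>\<parallel>x\<parallel>\<^sup>2 - 2 f x\<close>; the parallelogram law makes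
  minimising sequences Cauchy.\<close>

lemma riesz_representation:
  fixes f :: "'h::{real_inner,complete_space} \<Rightarrow> real"
  assumes "bounded_linear f"
  obtains l where "\<And>v. f v = inner l v"
proof -
  interpret f: bounded_linear f by fact
  define g where "g x = (norm x)\<^sup>2 - 2 * f x" for x
  obtain M where M: "\<And>x. norm (f x) \<le> norm x * M"
    using f.bounded by blast
  \<comment> \<open>Completing the square: \<open>g x\<close> is at least (norm x - M)^2 -
    M^2.\<close>
  have "- M\<^sup>2 \<le> g x" for x
  proof -
    have "f x \<le> norm x * M"
      using M[of x] by simp
    moreover have "0 \<le> (norm x - M)\<^sup>2"
      by simp
    ultimately show ?thesis
      unfolding g_def by (simp add: power2_diff)
  qed
  then have bdd: "bdd_below (range g)"
    by (auto intro!: bdd_belowI)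
  define m where "m = Inf (range g)"
  have m: "m \<le> g x" for x
    unfolding m_def by (intro cInf_lower bdd) auto
  have "\<exists>x. g x < m + e" if "e > 0" for e
    using cInf_lessD[of "range g" "m + e"] that by (auto simp: m_def)
  then have "\<exists>x. g x < m + inverse (real (Suc n))" for n
    by simp
  then obtain x where x: "\<And>n. g (x n) < m + inverse (real (Suc n))"
    by metis
  have par: "(norm (u - v))\<^sup>2 \<le> 2 * (g u - m) + 2 * (g v - m)" for u v
  proof -
    have "g ((1/2) *\<^sub>R (u + v)) = (norm (u + v))\<^sup>2 / 4 - (f u + f v)"
      unfolding g_def norm_scaleR f.scaleR f.add by (simp add: power_mult_distrib power_divide field_simps)
    moreover have "(norm (u - v))\<^sup>2 + (norm (u + v))\<^sup>2 = 2 * (norm u)\<^sup>2 + 2 * (norm v)\<^sup>2"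
      by (simp add: power2_norm_eq_inner inner_diff inner_add inner_commute)
    ultimately show ?thesis
      using m[of "(1/2) *\<^sub>R (u + v)"] unfolding g_def by argo
  qed
  have "Cauchy x"
  proof (rule metric_CauchyI)
    fix e :: real assume "e > 0"
    then obtain N where N: "inverse (real (Suc N)) < e\<^sup>2 / 4"
      using reals_Archimedean[of "e\<^sup>2 / 4"] by auto
    have small: "g (x n) - m < e\<^sup>2 / 4" if "n \<ge> N" for n
    proof -
      have "inverse (real (Suc n)) \<le> inverse (real (Suc N))"
        using that by (intro le_imp_inverse_le) auto
      then show ?thesis
        using x[of n] N by linarith
    qed
    show "\<exists>N. \<forall>i\<ge>N. \<forall>j\<ge>N. dist (x i) (x j) < e"
    proof (intro exI allI impI)
      fix i j assume "i \<ge> N" "j \<ge> N"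
      then have "2 * (g (x i) - m) + 2 * (g (x j) - m) < 2 * (e\<^sup>2 / 4) + 2 * (e\<^sup>2 / 4)"
        by (intro add_strict_mono mult_strict_left_mono small) auto
      then have "(norm (x i - x j))\<^sup>2 < e\<^sup>2"
        using par[of "x i" "x j"] by simp
      then show "dist (x i) (x j) < e"
        using \<open>e > 0\<close> by (simp add: dist_norm power_less_imp_less_base)
    qed
  qed
  then obtain l where l: "x \<longlonglongrightarrow> l"
    using Cauchy_convergent convergent_def by blast
  have "(\<lambda>n. g (x n)) \<longlonglongrightarrow> g l"
    unfolding g_def by (intro tendsto_intros l f.tendsto)
  moreover have "(\<lambda>n. m + inverse (real (Suc n))) \<longlonglongrightarrow> m + 0"
    by (intro tendsto_intros LIMSEQ_inverse_real_of_nat)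
  ultimately have "g l \<le> m + 0"
    by (rule LIMSEQ_le) (use x in \<open>auto intro!: exI[of _ 0] less_imp_le\<close>)
  have "f v = inner l v" for v
  proof -
    \<comment> \<open>First variation of \<open>g\<close> at its minimiser \<open>l\<close> in
      direction \<open>v\<close>: a quadratic in \<open>s\<close> without constant term that is
      never negative, so its linear coefficient vanishes.\<close>
    have "2 * s * (inner l v - f v) + s\<^sup>2 * (norm v)\<^sup>2 \<ge> 0" for s
    proof -
      have "g (l + s *\<^sub>R v) = g l + (2 * s * (inner l v - f v) + s\<^sup>2 * (norm v)\<^sup>2)"
        unfolding g_def power2_norm_eq_inner
        by (simp add: f.add f.scaleR inner_add inner_commute algebra_simps power2_eq_square)
      then show ?thesis
        using \<open>g l \<le> m + 0\<close> m[of "l + s *\<^sub>R v"] by linarith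
    qed
    from quadratic_nonneg_imp_zero[OF this] show ?thesis
      by simp
  qed
  then show thesis
    using that by blast
qed

text \<open>By Tychonoff's theorem for the functionals \<open>inner (x k)\<close>.
  Filters replace subsequences, so that separability plays no role.\<close>

lemma bounded_imp_weak_limit:
  fixes x :: "'i \<Rightarrow> 'h::{real_inner,complete_space}"
  assumes M: "\<And>k. norm (x k) \<le> M" and F: "F \<noteq> bot"
  obtains G l where "G \<le> F" "G \<noteq> bot" "weak_limit x l G"
proof -
  \<comment> \<open>By Cauchy-Schwarz every functional \<open>inner (x k)\<close> lies in this box,
    which is compact in the product topology.\<close>
  define K where "K = (\<Pi>\<^sub>E v\<in>UNIV::'h set. {- (M * norm v)..M * norm v})"
  define h where "h k = (\<lambda>v. inner (x k) v)" for k
  have "compactin (product_topology (\<lambda>_. euclidean) UNIV) K"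
    unfolding K_def compactin_PiE by auto
  then have "compact K"
    by (simp add: euclidean_product_topology)
  have bnd: "\<bar>inner (x k) v\<bar> \<le> M * norm v" for k v
    using Cauchy_Schwarz_ineq2[of "x k" v] mult_right_mono[OF M[of k] norm_ge_zero[of v]]
    by linarith
  then have "h k \<in> K" for k
    by (auto simp: K_def h_def abs_le_iff minus_le_iff)
  then have "eventually (\<lambda>z. z \<in> K) (filtermap h F)"
    by (simp add: eventually_filtermap)
  moreover have "filtermap h F \<noteq> bot"
    using F by (simp add: filtermap_bot_iff)
  ultimately obtain f where f: "inf (nhds f) (filtermap h F) \<noteq> bot"
    using \<open>compact K\<close> unfolding compact_filter by blast
  \<comment> \<open>Intersecting \<open>F\<close> with the preimages of the neighbourhoods of the
    cluster point \<open>f\<close> turns clustering along \<open>F\<close> into convergence along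
    \<open>G\<close>.\<close>
  define G where "G = inf F (filtercomap h (nhds f))"
  have "G \<noteq> bot"
  proof
    assume "G = bot"
    then obtain P Q where PQ: "eventually P F" "eventually Q (nhds f)" "\<And>k. P k \<Longrightarrow> \<not> Q (h k)"
      unfolding G_def trivial_limit_def eventually_inf eventually_filtercomap by metis
    have "eventually (\<lambda>z. \<not> Q z) (filtermap h F)"
      unfolding eventually_filtermap using PQ(1,3) by (auto elim: eventually_mono)
    with PQ(2) have "eventually (\<lambda>z. False) (inf (nhds f) (filtermap h F))"
      unfolding eventually_inf by blast
    with f show False
      by (simp add: trivial_limit_def)
  qed
  have "filterlim h (nhds f) G"
    unfolding filterlim_def filtermap_le_iff_le_filtercomap G_def by simp
  then have lim: "((\<lambda>k. inner (x k) v) \<longlongrightarrow> f v) G" for v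
  proof -
    have "((\<lambda>z::'h \<Rightarrow> real. z v) \<longlongrightarrow> f v) (nhds f)"
    proof (rule topological_tendstoI)
      fix T :: "real set" assume T: "open T" "f v \<in> T"
      have "open ((\<lambda>z::'h \<Rightarrow> real. z v) -` T)"
        using T(1) continuous_on_product_coordinates by (rule open_vimage)
      with T(2) show "\<forall>\<^sub>F z in nhds f. z v \<in> T"
        unfolding eventually_nhds by (intro exI[of _ "(\<lambda>z. z v) -` T"]) simp
    qed
    from filterlim_compose[OF this \<open>filterlim h (nhds f) G\<close>] show ?thesis
      by (simp add: h_def)
  qed
  have "bounded_linear f"
  proof
    show "f (u + v) = f u + f v" for u v
      using tendsto_unique[OF \<open>G \<noteq> bot\<close> lim] tendsto_add[OF lim[of u] lim[of v]]
      by (simp add: inner_add_right)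
    show "f (r *\<^sub>R v) = r *\<^sub>R f v" for r v
      using tendsto_unique[OF \<open>G \<noteq> bot\<close> lim] tendsto_mult_left[OF lim[of v], of r] by simp
    have "\<bar>f v\<bar> \<le> M * norm v" for v
      by (rule tendsto_upperbound[OF tendsto_rabs[OF lim]])
        (use bnd \<open>G \<noteq> bot\<close> in auto)
    then show "\<exists>K. \<forall>v. norm (f v) \<le> norm v * K"
      by (auto simp: mult.commute)
  qed
  then obtain l where "\<And>v. f v = inner l v"
    using riesz_representation by blast
  with lim have "weak_limit x l G"
    by (simp add: weak_limit_def)
  then show thesis
    using that[of G] \<open>G \<noteq> bot\<close> by (simp add: G_def)
qed

lemma tendsto_inner_weak_strong:
  fixes x r :: "'i \<Rightarrow> 'h::real_inner"
  assumes M: "\<And>k. norm (x k) \<le> M" and r: "(r \<longlongrightarrow> 0) F"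
  shows "((\<lambda>k. inner (x k) (r k)) \<longlongrightarrow> 0) F"
proof (rule Lim_null_comparison)
  show "\<forall>\<^sub>F k in F. norm (inner (x k) (r k)) \<le> M * norm (r k)"
    using order_trans[OF Cauchy_Schwarz_ineq2 mult_right_mono[OF M norm_ge_zero]] by simp
  show "((\<lambda>k. M * norm (r k)) \<longlongrightarrow> 0) F"
    using tendsto_mult_right_zero[OF tendsto_norm_zero[OF r]] .
qed

text \<open>The squared distances to two weak cluster points differ by an affine function of
  \<open>x k\<close>. Since both distances converge along the whole sequence, so does the inner
  product with the difference of the two points; its limits along two filters must agree, which
  forces the points to coincide.\<close>

lemma opial:
  fixes x :: "nat \<Rightarrow> 'h::{real_inner,complete_space}"
  assumes ne: "S \<noteq> {}"
    and conv: "\<And>p. p \<in> S \<Longrightarrow> convergent (\<lambda>k. norm (x k - p))"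
    and clus: "\<And>G l. G \<le> sequentially \<Longrightarrow> G \<noteq> bot \<Longrightarrow> weak_limit x l G \<Longrightarrow> l \<in> S"
  shows "\<exists>l\<in>S. weakly_converges x l"
proof -
  from ne obtain p where "p \<in> S" by auto
  from conv[OF this] have "Bseq (\<lambda>k. norm (x k - p))"
    by (rule convergent_imp_Bseq)
  then obtain M where "\<And>k. norm (x k - p) \<le> M"
    unfolding Bseq_def by auto
  then have M: "norm (x k) \<le> M + norm p" for k
    using norm_triangle_sub[of "x k" p] by (smt (verit))
  obtain G l where G: "G \<le> sequentially" "G \<noteq> bot" "weak_limit x l G"
    using bounded_imp_weak_limit[of x, OF M sequentially_bot] by metis
  have "l \<in> S"
    using clus G by blast
  have uniq: "l' = l" if H: "H \<le> sequentially" "H \<noteq> bot" "weak_limit x l' H" for H l'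
  proof -
    have "l' \<in> S"
      using clus H by blast
    obtain c c' where c: "(\<lambda>k. norm (x k - l)) \<longlonglongrightarrow> c" and c': "(\<lambda>k. norm (x k - l')) \<longlonglongrightarrow> c'"
      using conv[OF \<open>l \<in> S\<close>] conv[OF \<open>l' \<in> S\<close>] by (auto simp: convergent_def)
    have eq: "inner (x k) (l' - l) =
        ((norm (x k - l))\<^sup>2 - (norm (x k - l'))\<^sup>2 + (norm l')\<^sup>2 - (norm l)\<^sup>2) / 2" for k
      unfolding power2_norm_eq_inner by (simp add: inner_diff inner_commute)
    have lim: "(\<lambda>k. inner (x k) (l' - l)) \<longlonglongrightarrow> (c\<^sup>2 - c'\<^sup>2 + (norm l')\<^sup>2 - (norm l)\<^sup>2) / 2"
      unfolding eq by (intro tendsto_intros c c') auto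
    have "inner l (l' - l) = (c\<^sup>2 - c'\<^sup>2 + (norm l')\<^sup>2 - (norm l)\<^sup>2) / 2"
      by (rule tendsto_unique[OF G(2) weak_limitD[OF G(3)] tendsto_mono[OF G(1) lim]])
    moreover have "inner l' (l' - l) = (c\<^sup>2 - c'\<^sup>2 + (norm l')\<^sup>2 - (norm l)\<^sup>2) / 2"
      by (rule tendsto_unique[OF H(2) weak_limitD[OF H(3)] tendsto_mono[OF H(1) lim]])
    ultimately have "inner (l' - l) (l' - l) = 0"
      by (simp add: inner_diff_left)
    then show ?thesis
      by simp
  qed
  have "(\<lambda>k. inner (x k) v) \<longlonglongrightarrow> inner l v" for v
  proof (rule ccontr)
    assume "\<not> ?thesis"
    then obtain e where e: "e > 0" and ev: "\<not> (\<forall>\<^sub>F k in sequentially. dist (inner (x k) v) (inner l v) < e)"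
      by (auto simp: tendsto_iff)
    \<comment> \<open>If convergence against \<open>v\<close> fails, the indices at distance at
      least \<open>e\<close> support a proper filter. It has a weak cluster point of its own, which
      uniqueness identifies with \<open>l\<close>, a contradiction.\<close>
    define H where "H = inf sequentially (principal {k. dist (inner (x k) v) (inner l v) \<ge> e})"
    have "H \<noteq> bot"
      using ev unfolding H_def trivial_limit_def eventually_inf_principal
      by (simp add: not_less[symmetric] del: not_less)
    then obtain H' l' where H': "H' \<le> H" "H' \<noteq> bot" "weak_limit x l' H'"
      using bounded_imp_weak_limit[of x, OF M] by metis
    moreover have "H \<le> sequentially"
      by (simp add: H_def)
    ultimately have "l' = l"
      using uniq order_trans by blast
    with H'(3) have "\<forall>\<^sub>F k in H'. dist (inner (x k) v) (inner l v) < e"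
      using e tendstoD weak_limitD by blast
    moreover have "\<forall>\<^sub>F k in H'. dist (inner (x k) v) (inner l v) \<ge> e"
      using H'(1) unfolding H_def by (simp add: le_inf_iff le_principal)
    ultimately have "\<forall>\<^sub>F k in H'. False"
      by eventually_elim simp
    with H'(2) show False
      by (simp add: trivial_limit_def)
  qed
  with \<open>l \<in> S\<close> show ?thesis
    by (auto simp: weakly_converges_def)
qed

lemma weakly_converges_offset:
  assumes "weakly_converges (\<lambda>k. x (k + n)) l"
  shows "weakly_converges x l"
  unfolding weakly_converges_def
proof
  fix y
  show "(\<lambda>k. inner (x k) y) \<longlonglongrightarrow> inner l y"
    by (rule LIMSEQ_offset[where k = n]) (use assms in \<open>simp add: weakly_converges_def\<close>)
qed

subsection \<open>Monotone operators\<close>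

text \<open>Adjoining the pair \<open>(p, u)\<close> to the graph keeps it monotone, so maximality
  says that it was there already.\<close>

lemma maximally_monotoneD:
  assumes "maximally_monotone A" and "\<And>x a. a \<in> A x \<Longrightarrow> inner (p - x) (u - a) \<ge> 0"
  shows "u \<in> A p"
proof -
  define A' where "A' = A(p := insert u (A p))"
  have "monotone_op A"
    using assms(1) by (simp add: maximally_monotone_def)
  then have mono: "inner (x - y) (a - b) \<ge> 0" if "a \<in> A x" "b \<in> A y" for x y a b
    using that by (auto simp: monotone_op_def)
  have sym: "inner (x - p) (a - u) \<ge> 0" if "a \<in> A x" for x a
    using assms(2)[OF that] by (metis inner_minus_left inner_minus_right minus_diff_eq)
  have "monotone_op A'"
    unfolding monotone_op_def A'_def
    using mono assms(2) sym by (auto split: if_splits)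
  moreover have "\<forall>x. A x \<subseteq> A' x"
    by (auto simp: A'_def)
  ultimately have "A' = A"
    using assms(1) by (auto simp: maximally_monotone_def)
  then show ?thesis
    by (metis A'_def fun_upd_same insertI1)
qed

text \<open>Minty's device: test monotonicity at \<open>u - s v\<close> and let \<open>s\<close> tend to zero.\<close>

lemma minty:
  fixes B :: "'h::real_inner \<Rightarrow> 'h"
  assumes cont: "continuous_on UNIV B"
    and mono: "\<And>y. inner (u - y) (w - B y) \<ge> 0"
  shows "w = B u"
proof -
  \<comment> \<open>In this direction the limiting inequality reads 0 \<le> -
    \<open>inner v v\<close>.\<close>
  define v where "v = B u - w"
  have "0 \<le> inner v (w - B (u - inverse (real (Suc n)) *\<^sub>R v))" for n
    using mono[of "u - inverse (real (Suc n)) *\<^sub>R v"] by (simp add: zero_le_mult_iff)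
  moreover have "(\<lambda>n. inner v (w - B (u - inverse (real (Suc n)) *\<^sub>R v))) \<longlonglongrightarrow> inner v (w - B (u - 0 *\<^sub>R v))"
    by (intro tendsto_intros continuous_on_tendsto_compose[OF cont] LIMSEQ_inverse_real_of_nat) auto
  ultimately have "inner v (w - B (u - 0 *\<^sub>R v)) \<ge> 0"
    by (intro LIMSEQ_le_const) auto
  then have "inner v v \<le> 0"
    by (simp add: v_def inner_diff_right)
  then have "v = 0"
    using inner_gt_zero_iff[of v] by linarith
  then show ?thesis
    by (simp add: v_def)
qed

text \<open>Any value of a monotone extension at \<open>x\<close> is monotonically related to the
  whole graph of \<open>B\<close>, so \<open>minty\<close> identifies it with
  \<open>B x\<close>.\<close>

lemma continuous_monotone_imp_maximally_monotone:
  fixes B :: "'h::real_inner \<Rightarrow> 'h"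
  assumes "continuous_on UNIV B" and "monotone_op (\<lambda>x. {B x})"
  shows "maximally_monotone (\<lambda>x. {B x})"
  unfolding maximally_monotone_def
proof (intro conjI allI impI ext)
  fix A' :: "'h \<Rightarrow> 'h set" and x
  assume A': "monotone_op A' \<and> (\<forall>x. {B x} \<subseteq> A' x)"
  have "u = B x" if "u \<in> A' x" for u
    using A' that by (intro minty[OF assms(1)]) (auto simp: monotone_op_def)
  with A' show "A' x = {B x}"
    by auto
qed (fact assms(2))

lemma zer_sum_single_iff: "p \<in> zer (\<lambda>x. A x + {B x}) \<longleftrightarrow> - B p \<in> (A p :: 'h::real_vector set)"
proof -
  have "0 = a + B p \<longleftrightarrow> a = - B p" for a
    by (metis add_eq_0_iff2 eq_commute)
  then show ?thesis
    by (simp add: zer_def set_plus_def)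
qed

text \<open>Monotonicity of \<open>A\<close> and of \<open>B\<close> bound the limit of
  \<open>inner (x k) (B (x k))\<close> from both sides, so no resolvent of \<open>A + B\<close> is needed.\<close>

lemma weak_limit_in_zer:
  fixes A :: "'h::{real_inner,complete_space} \<Rightarrow> 'h set"
  assumes max: "maximally_monotone A" and mono: "monotone_op (\<lambda>x. {B x})"
    and lip: "L-lipschitz_on UNIV B"
    and a: "\<And>k. a k \<in> A (x k)" and lim0: "(\<lambda>k. a k + B (x k)) \<longlonglongrightarrow> 0"
    and bound: "\<And>k. norm (x k) \<le> M"
    and G: "G \<le> sequentially" "G \<noteq> bot" "weak_limit x l G"
  shows "l \<in> zer (\<lambda>x. A x + {B x})"
proof -
  define r where "r k = a k + B (x k)" for k
  have B: "inner (u - v) (B u - B v) \<ge> 0" for u v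
    using mono by (auto simp: monotone_op_def)
  have A: "inner (u - v) (c - d) \<ge> 0" if "c \<in> A u" "d \<in> A v" for u v c d
    using max that by (auto simp: maximally_monotone_def monotone_op_def)
  have boundB: "norm (B (x k)) \<le> L * M + norm (B 0)" for k
  proof -
    have "norm (B (x k) - B 0) \<le> L * norm (x k)"
      using lipschitz_onD[OF lip, of "x k" 0] by (simp add: dist_norm)
    also have "\<dots> \<le> L * M"
      using bound[of k] lipschitz_on_nonneg[OF lip] by (rule mult_left_mono)
    finally show ?thesis
      using norm_triangle_sub[of "B (x k)" "B 0"] by linarith
  qed
  \<comment> \<open>Refining the filter makes the bounded values \<open>B (x k)\<close> converge
    weakly too. It remains to show that \<open>- b\<close> lies in \<open>A l\<close> and that
    \<open>b\<close> equals \<open>B l\<close>.\<close>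
  obtain H b where H: "H \<le> G" "H \<noteq> bot" and b: "weak_limit (\<lambda>k. B (x k)) b H"
    using bounded_imp_weak_limit[of "\<lambda>k. B (x k)", OF boundB G(2)] by metis
  have wx: "((\<lambda>k. inner (x k) v) \<longlongrightarrow> inner l v) H" for v
    using tendsto_mono[OF H(1) weak_limitD[OF G(3)]] .
  have wb: "((\<lambda>k. inner (B (x k)) v) \<longlongrightarrow> inner b v) H" for v
    using weak_limitD[OF b] .
  have "(r \<longlongrightarrow> 0) sequentially"
    using lim0 by (simp add: r_def[abs_def])
  then have r: "(r \<longlongrightarrow> 0) H"
    using tendsto_mono order_trans H(1) G(1) by blast
  have xr: "((\<lambda>k. inner (x k) (r k)) \<longlongrightarrow> 0) H"
    by (rule tendsto_inner_weak_strong[OF bound r])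
  have vr: "((\<lambda>k. inner v (r k)) \<longlongrightarrow> 0) H" for v
    using tendsto_inner[OF tendsto_const r, of v] by simp
  \<comment> \<open>Both factors converge only weakly, so the limit of this product is not
    automatic; it is squeezed between \<open>lo\<close> and \<open>up\<close>.\<close>
  define t where "t k = inner (x k) (B (x k))" for k
  \<comment> \<open>Obtained by expanding monotonicity of \<open>A\<close> between
    \<open>x k\<close>, with \<open>a k = r k - B (x k)\<close>, and a pair \<open>(u, d)\<close> of
    the graph.\<close>
  define up where "up u d k =
    inner (x k) (r k) - inner (x k) d - inner u (r k) + inner (B (x k)) u + inner u d" for u d k
  have up: "t k \<le> up u d k" if "d \<in> A u" for u d k
  proof -
    have "0 \<le> inner (x k - u) (r k - B (x k) - d)"
      using A[OF a that, of k] by (simp add: r_def)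
    then show ?thesis
      by (simp add: up_def t_def inner_diff inner_commute)
  qed
  have uplim: "(up u d \<longlongrightarrow> inner b u - inner l d + inner u d) H" for u d
    using tendsto_add[OF tendsto_add[OF tendsto_diff[OF tendsto_diff[OF xr wx[of d]] vr[of u]] wb[of u]]
        tendsto_const[of "inner u d"]]
    by (simp add: up_def[abs_def] algebra_simps)
  define lo where "lo k = inner (x k) (B l) + inner (B (x k)) l - inner l (B l)" for k
  have lo: "lo k \<le> t k" for k
    using B[of "x k" l] by (simp add: lo_def t_def inner_diff inner_commute)
  have lolim: "(lo \<longlongrightarrow> inner b l) H"
    using tendsto_diff[OF tendsto_add[OF wx[of "B l"] wb[of l]] tendsto_const[of "inner l (B l)"]]
    by (simp add: lo_def[abs_def])
  \<comment> \<open>Comparing the limits of \<open>lo\<close> and \<open>up\<close> yields the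
    monotone relation of \<open>(l, - b)\<close> to every pair of the graph of
    \<open>A\<close>.\<close>
  have bA: "- b \<in> A l"
  proof (rule maximally_monotoneD[OF max])
    fix u d assume "d \<in> A u"
    then have "inner b l \<le> inner b u - inner l d + inner u d"
      by (intro tendsto_le[OF H(2) uplim lolim] always_eventually allI order_trans[OF lo up])
    then show "0 \<le> inner (l - u) (- b - d)"
      by (simp add: inner_diff inner_commute)
  qed
  \<comment> \<open>Now that \<open>- b\<close> lies in \<open>A l\<close>, the upper bound may be
    taken at \<open>(l, - b)\<close>, where its limit meets that of \<open>lo\<close>.\<close>
  have tlim: "(t \<longlongrightarrow> inner b l) H"
  proof (rule tendsto_sandwich[OF _ _ lolim])
    show "(up l (- b) \<longlongrightarrow> inner b l) H"
      using uplim[of l "- b"] by (simp add: inner_commute)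
  qed (use lo up[OF bA] in auto)
  have "b = B l"
  proof (rule minty[of B l b])
    show "continuous_on UNIV B"
      by (rule lipschitz_on_continuous_on[OF lip])
    fix v
    have "((\<lambda>k. t k - inner (x k) (B v) - inner (B (x k)) v + inner v (B v))
        \<longlongrightarrow> inner b l - inner l (B v) - inner b v + inner v (B v)) H"
      by (intro tendsto_intros tlim wx wb)
    moreover have "0 \<le> t k - inner (x k) (B v) - inner (B (x k)) v + inner v (B v)" for k
      using B[of "x k" v] by (simp add: t_def inner_diff inner_commute)
    ultimately have "0 \<le> inner b l - inner l (B v) - inner b v + inner v (B v)"
      by (intro tendsto_lowerbound[OF _ _ H(2)]) auto
    then show "0 \<le> inner (l - v) (b - B v)"
      by (simp add: inner_diff inner_commute)
  qed
  with bA show ?thesis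
    by (simp add: zer_sum_single_iff)
qed

lemma asymptotically_regular_imp_weakly_converges:
  fixes A :: "'h::{real_inner,complete_space} \<Rightarrow> 'h set"
  assumes "maximally_monotone A" "monotone_op (\<lambda>x. {B x})" "L-lipschitz_on UNIV B"
    and ne: "zer (\<lambda>x. A x + {B x}) \<noteq> {}"
    and "\<And>k. a k \<in> A (x k)" "(\<lambda>k. a k + B (x k)) \<longlonglongrightarrow> 0"
    and conv: "\<And>p. p \<in> zer (\<lambda>x. A x + {B x}) \<Longrightarrow> convergent (\<lambda>k. norm (x k - p))"
  shows "\<exists>l\<in>zer (\<lambda>x. A x + {B x}). weakly_converges x l"
proof (rule opial[OF ne conv])
  from ne obtain p where "p \<in> zer (\<lambda>x. A x + {B x})"
    by auto
  from convergent_imp_Bseq[OF conv[OF this]] obtain M where "\<And>k. norm (x k - p) \<le> M"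
    unfolding Bseq_def by auto
  then have "norm (x k) \<le> M + norm p" for k
    using norm_triangle_sub[of "x k" p] by (smt (verit))
  then show "l \<in> zer (\<lambda>x. A x + {B x})"
    if "G \<le> sequentially" "G \<noteq> bot" "weak_limit x l G" for G l
    by (rule weak_limit_in_zer[OF assms(1-3) assms(5,6) _ that])
qed

subsection \<open>The Lyapunov function\<close>

lemma descent_convergent:
  fixes E s :: "nat \<Rightarrow> real"
  assumes "\<And>k. E k \<ge> 0" "\<And>k. s k \<ge> 0" and desc: "\<And>k. E (Suc k) + s k \<le> E k"
  shows "convergent E" "s \<longlonglongrightarrow> 0"
proof -
  have "decseq E"
    using assms(2) desc by (intro decseq_SucI) (smt (verit))
  then obtain c where c: "E \<longlonglongrightarrow> c"
    using decseq_convergent assms(1) by blast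
  then show "convergent E"
    by (auto simp: convergent_def)
  have "(\<lambda>k. E k - E (Suc k)) \<longlonglongrightarrow> c - c"
    by (intro tendsto_diff c LIMSEQ_Suc[OF c])
  moreover have "s k \<le> E k - E (Suc k)" for k
    using desc[of k] by linarith
  ultimately show "s \<longlonglongrightarrow> 0"
    using assms(2) by (intro real_tendsto_sandwich[OF _ _ tendsto_const[of 0], of s]) auto
qed

text \<open>Both methods satisfy the hypothesis \<open>step\<close>, with \<open>b\<close> the forward values scaled by the step
  size and \<open>c\<close> the forward value at the solution \<open>p\<close>; the potential \<open>phi\<close> vanishes for the
  forward-reflected-backward method.\<close>

lemma energy_descent:
  fixes y b :: "nat \<Rightarrow> 'h::real_inner"
  assumes step: "\<And>k. inner (y (k+1) - y (k+2) - 2 *\<^sub>R b (k+1) + b k + c) (y (k+2) - p)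
                    \<ge> 2 * phi (k+1) - phi k"
    and phi: "\<And>k. phi k \<ge> 0"
    and mono: "\<And>k. inner (b k - c) (y k - p) \<ge> 0"
    and lip: "\<And>k. norm (b (k+1) - b k) \<le> l * norm (y (k+1) - y k)"
    and l: "0 \<le> l" "l < 1/2"
  shows "(\<lambda>k. y (k+1) - y k) \<longlonglongrightarrow> 0" "convergent (\<lambda>k. norm (y k - p))"
proof -
  define d q \<beta> where "d k = y (k+1) - y k" and "q k = y k - p" and "\<beta> k = b (k+1) - b k" for k
  define E where "E k = (norm (q (k+1)))\<^sup>2 - 2 * inner (\<beta> k) (q (k+1)) + l * (norm (d k))\<^sup>2 + 2 * phi k" for k
  \<comment> \<open>In \<open>desc\<close>, the term l (norm D)^2 is charged twice: once as part of
    \<open>E (Suc k)\<close>, once by Young's inequality for \<open>inner (\<beta> k) D\<close>. The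
    implicit step supplies one full (norm D)^2, so 1 - 2 l is left over; this is where l < 1/2
    enters.\<close>
  define s where "s k = (1 - 2 * l) * (norm (d (k+1)))\<^sup>2 + 2 * phi (k+1)" for k
  have lip': "norm (\<beta> k) \<le> l * norm (d k)" for k
    using lip by (simp add: \<beta>_def d_def)
  have amgm: "\<bar>2 * inner (\<beta> k) v\<bar> \<le> l * (norm (d k))\<^sup>2 + l * (norm v)\<^sup>2" for k v
  proof -
    have "\<bar>inner (\<beta> k) v\<bar> \<le> norm (\<beta> k) * norm v"
      by (rule Cauchy_Schwarz_ineq2)
    also have "\<dots> \<le> l * norm (d k) * norm v"
      by (rule mult_right_mono[OF lip' norm_ge_zero])
    finally have "\<bar>2 * inner (\<beta> k) v\<bar> \<le> l * (2 * norm (d k) * norm v)"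
      by simp
    also have "\<dots> \<le> l * ((norm (d k))\<^sup>2 + (norm v)\<^sup>2)"
      by (rule mult_left_mono[OF sum_squares_bound l(1)])
    finally show ?thesis
      by (simp add: distrib_left)
  qed
  have desc: "E (Suc k) + s k \<le> E k" for k
  proof -
    define D Q \<delta> where "D = d (k+1)" and "Q = q (k+1)" and "\<delta> = b (k+2) - c"
    have q2: "q (k+2) = Q + D"
      by (simp add: q_def Q_def D_def d_def)
    have "y (k+1) - y (k+2) - 2 *\<^sub>R b (k+1) + b k + c = \<beta> (k+1) - \<beta> k - D - \<delta>"
      by (simp add: D_def d_def \<beta>_def \<delta>_def scaleR_2)
    then have "inner (\<beta> (k+1) - \<beta> k - D - \<delta>) (Q + D) \<ge> 2 * phi (k+1) - phi k"
      using step[of k] q2 by (simp add: q_def)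
    moreover have "inner \<delta> (Q + D) \<ge> 0"
      using mono[of "k+2"] q2 by (simp add: \<delta>_def q_def)
    moreover have "\<bar>2 * inner (\<beta> k) D\<bar> \<le> l * (norm (d k))\<^sup>2 + l * (norm D)\<^sup>2"
      by (rule amgm)
    moreover have "(norm (Q + D))\<^sup>2 = (norm Q)\<^sup>2 + 2 * inner D Q + inner D D"
      and "(norm D)\<^sup>2 = inner D D"
      unfolding power2_norm_eq_inner by (simp_all add: inner_add inner_commute)
    moreover have "E (Suc k) = (norm (Q + D))\<^sup>2 - 2 * inner (\<beta> (k+1)) (Q + D)
        + l * (norm D)\<^sup>2 + 2 * phi (k+1)"
      using q2 by (simp add: E_def D_def)
    moreover have "E k = (norm Q)\<^sup>2 - 2 * inner (\<beta> k) Q + l * (norm (d k))\<^sup>2 + 2 * phi k"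
      by (simp add: E_def Q_def)
    moreover have "s k = (norm D)\<^sup>2 - 2 * (l * (norm D)\<^sup>2) + 2 * phi (k+1)"
      by (simp add: s_def D_def algebra_simps)
    ultimately show ?thesis
      by (simp add: inner_add_right inner_diff_left abs_le_iff)
  qed
  \<comment> \<open>Young's inequality absorbs the cross term, so \<open>E\<close> controls the
    squared distance to \<open>p\<close> although its sign is not evident.\<close>
  have E_lower: "(1 - l) * (norm (q (k+1)))\<^sup>2 \<le> E k" for k
    using amgm[of k "q (k+1)"] phi[of k] by (simp add: E_def algebra_simps)
  have s0: "s k \<ge> 0" for k
    using l phi[of "k+1"] by (simp add: s_def)
  have E0: "E k \<ge> 0" for k
    using l by (intro order_trans[OF _ E_lower]) simp
  have convE: "convergent E" and s: "s \<longlonglongrightarrow> 0"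
    using descent_convergent[of E s, OF E0 s0 desc] by auto
  have "(\<lambda>k. (1 - 2 * l) * (norm (d (k+1)))\<^sup>2) \<longlonglongrightarrow> 0"
    using l phi by (intro real_tendsto_sandwich[OF _ _ tendsto_const[of 0] s]) (auto simp: s_def)
  from tendsto_mult_left[OF this, of "inverse (1 - 2 * l)"]
  have "(\<lambda>k. (norm (d (k+1)))\<^sup>2) \<longlonglongrightarrow> 0"
    using l by (simp add: mult.assoc[symmetric])
  from tendsto_real_sqrt[OF this] have "(\<lambda>k. d (k+1)) \<longlonglongrightarrow> 0"
    by (simp add: tendsto_norm_zero_iff)
  then have d: "d \<longlonglongrightarrow> 0"
    using LIMSEQ_offset[of d 1] by simp
  then show "(\<lambda>k. y (k+1) - y k) \<longlonglongrightarrow> 0"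
    by (simp add: d_def[abs_def])
  have "(\<lambda>k. phi (k+1)) \<longlonglongrightarrow> 0"
  proof (rule real_tendsto_sandwich[OF _ _ tendsto_const[of 0]])
    show "(\<lambda>k. s k / 2) \<longlonglongrightarrow> 0"
      using tendsto_divide[OF s tendsto_const[of 2]] by simp
    show "\<forall>\<^sub>F k in sequentially. phi (k+1) \<le> s k / 2"
      using l by (simp add: s_def)
  qed (use phi in auto)
  then have phi0: "phi \<longlonglongrightarrow> 0"
    using LIMSEQ_offset[of phi 1] by simp
  have "decseq E"
    using s0 desc by (intro decseq_SucI) (smt (verit))
  then have "E k \<le> E 0" for k
    by (simp add: decseq_def)
  then have "(norm (q (k+1)))\<^sup>2 \<le> E 0 / (1 - l)" for k
    using E_lower[of k] l by (simp add: le_divide_eq mult.commute) (smt (verit))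
  then have Q: "norm (q (k+1)) \<le> sqrt (E 0 / (1 - l))" for k
    by (rule real_le_rsqrt)
  have "\<beta> \<longlonglongrightarrow> 0"
  proof (rule Lim_null_comparison)
    show "(\<lambda>k. l * norm (d k)) \<longlonglongrightarrow> 0"
      using tendsto_mult_left[OF tendsto_norm_zero[OF d], of l] by simp
  qed (use lip' in auto)
  then have "(\<lambda>k. inner (q (k+1)) (\<beta> k)) \<longlonglongrightarrow> 0"
    by (rule tendsto_inner_weak_strong[OF Q])
  \<comment> \<open>All terms by which \<open>E\<close> differs from the squared distance vanish, so
    that distance inherits the convergence of \<open>E\<close>.\<close>
  then have "(\<lambda>k. E k + 2 * inner (q (k+1)) (\<beta> k) - l * (norm (d k))\<^sup>2 - 2 * phi k) \<longlonglongrightarrow>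
      lim E + 2 * 0 - l * (norm (0::'h))\<^sup>2 - 2 * 0"
    using convE by (intro tendsto_intros d phi0) (simp_all add: convergent_LIMSEQ_iff)
  then have "(\<lambda>k. (norm (q (k+1)))\<^sup>2) \<longlonglongrightarrow> lim E"
    by (simp add: E_def[of _] inner_commute)
  from tendsto_real_sqrt[OF this] have "(\<lambda>k. norm (q (k+1))) \<longlonglongrightarrow> sqrt (lim E)"
    by simp
  then show "convergent (\<lambda>k. norm (y k - p))"
    using LIMSEQ_offset[of "\<lambda>k. norm (q k)" 1] by (auto simp: convergent_def q_def[abs_def])
qed

text \<open>With \<open>phi = inner u v\<close> and \<open>phi' = inner u' v'\<close>,
  \<open>inner (2 u' - u) (2 v' - v) = 2 phi' - phi + 2 inner (u' - u) (v' - v)\<close>.\<close>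

lemma inner_reflected:
  fixes u v u' v' :: "'h::real_inner"
  assumes "inner (u' - u) (v' - v) \<ge> 0"
  shows "inner (2 *\<^sub>R u' - u) (2 *\<^sub>R v' - v) \<ge> 2 * inner u' v' - inner u v"
  using assms by (simp add: inner_diff)

text \<open>A contraction by one half with vanishing forcing: once \<open>v\<close> stays below e/2,
  the excess of \<open>u\<close> over e/2 is at most halved at each step. It recovers the increments
  of the iterates from those of the reflected points.\<close>

lemma averaged_tendsto_zero:
  fixes u v :: "nat \<Rightarrow> real"
  assumes u: "\<And>k. u k \<ge> 0" and step: "\<And>k. u (Suc k) \<le> (u k + v k) / 2" and v: "v \<longlonglongrightarrow> 0"
  shows "u \<longlonglongrightarrow> 0"
proof (rule LIMSEQ_I)
  fix e :: real assume e: "e > 0"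
  obtain N where N: "\<And>k. k \<ge> N \<Longrightarrow> \<bar>v k\<bar> < e / 2"
    using LIMSEQ_D[OF v, of "e / 2"] e by auto
  have bound: "u (N + j) \<le> e / 2 + u N * (1/2) ^ j" for j
  proof (induction j)
    case (Suc j)
    have "u (N + Suc j) \<le> (u (N + j) + v (N + j)) / 2"
      using step[of "N + j"] by simp
    also have "\<dots> \<le> (e / 2 + u N * (1/2) ^ j + e / 2) / 2"
      using Suc N[of "N + j"] by (intro divide_right_mono add_mono) auto
    finally show ?case
      by (simp add: add_divide_distrib)
  qed (use e in simp)
  have "(\<lambda>j. u N * (1/2) ^ j) \<longlonglongrightarrow> u N * 0"
    by (intro tendsto_mult_left LIMSEQ_realpow_zero) auto
  then have "\<forall>\<^sub>F j in sequentially. u N * (1/2) ^ j < e / 2"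
    using e by (intro order_tendstoD) auto
  then obtain J where J: "\<And>j. j \<ge> J \<Longrightarrow> u N * (1/2) ^ j < e / 2"
    by (auto simp: eventually_sequentially)
  have "norm (u k - 0) < e" if "k \<ge> N + J" for k
  proof -
    have "k - N \<ge> J" "N + (k - N) = k"
      using that by auto
    then show ?thesis
      using bound[of "k - N"] J[of "k - N"] u[of k] by simp
  qed
  then show "\<exists>no. \<forall>k\<ge>no. norm (u k - 0) < e"
    by blast
qed

lemma convergent_norm_diff_close:
  fixes x y :: "nat \<Rightarrow> 'h::real_normed_vector"
  assumes "convergent (\<lambda>k. norm (y k - p))" and "(\<lambda>k. x k - y k) \<longlonglongrightarrow> 0"
  shows "convergent (\<lambda>k. norm (x k - p))"
proof -
  have "(\<lambda>k. norm (x k - p) - norm (y k - p)) \<longlonglongrightarrow> 0"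
  proof (rule Lim_null_comparison)
    show "\<forall>\<^sub>F k in sequentially. norm (norm (x k - p) - norm (y k - p)) \<le> norm (x k - y k)"
      by (intro always_eventually allI) (metis norm_triangle_ineq3 real_norm_def diff_diff_eq2 diff_add_cancel)
  qed (rule tendsto_norm_zero[OF assms(2)])
  then have "convergent (\<lambda>k. norm (x k - p) - norm (y k - p))"
    by (auto simp: convergent_def)
  from convergent_add[OF this assms(1)] show ?thesis
    by simp
qed

lemma lipschitz_diff_tendsto_zero:
  fixes B :: "'h::real_normed_vector \<Rightarrow> 'h"
  assumes "L-lipschitz_on UNIV B" and "((\<lambda>k. u k - v k) \<longlongrightarrow> 0) F"
  shows "((\<lambda>k. B (u k) - B (v k)) \<longlongrightarrow> 0) F"
proof (rule Lim_null_comparison)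
  show "\<forall>\<^sub>F k in F. norm (B (u k) - B (v k)) \<le> L * norm (u k - v k)"
    using lipschitz_onD[OF assms(1)] by (auto simp: dist_norm)
  show "((\<lambda>k. L * norm (u k - v k)) \<longlongrightarrow> 0) F"
    using tendsto_mult_left[OF tendsto_norm_zero[OF assms(2)], of L] by simp
qed

section \<open>Weak convergence of both methods below the threshold\<close>

theorem frb_weakly_converges:
  fixes A :: "'h::{real_inner,complete_space} \<Rightarrow> 'h set"
  assumes lam: "0 < lam" "lam * L < 1/2"
    and max: "maximally_monotone A" and mono: "monotone_op (\<lambda>x. {B x})"
    and lip: "L-lipschitz_on UNIV B"
    and ne: "zer (\<lambda>x. A x + {B x}) \<noteq> {}" and orbit: "frb lam A B x"
  shows "\<exists>l\<in>zer (\<lambda>x. A x + {B x}). weakly_converges x l"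
proof -
  have "\<exists>a. a \<in> A (x (k+2)) \<and>
      x (k+1) - (2 * lam) *\<^sub>R B (x (k+1)) + lam *\<^sub>R B (x k) = x (k+2) + lam *\<^sub>R a" for k
    using orbit by (auto simp: frb_def resolvent_def)
  then obtain a where aA: "\<And>k. a k \<in> A (x (k+2))"
    and a: "\<And>k. x (k+1) - (2 * lam) *\<^sub>R B (x (k+1)) + lam *\<^sub>R B (x k) = x (k+2) + lam *\<^sub>R a k"
    by metis
  have L: "0 \<le> lam * L"
    using lam(1) lipschitz_on_nonneg[OF lip] by simp
  have main: "(\<lambda>k. x (k+1) - x k) \<longlonglongrightarrow> 0 \<and> convergent (\<lambda>k. norm (x k - p))"
    if p: "p \<in> zer (\<lambda>x. A x + {B x})" for p
  proof -
    have pA: "- B p \<in> A p"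
      using p by (simp add: zer_sum_single_iff)
    have "inner (x (k+1) - x (k+2) - 2 *\<^sub>R lam *\<^sub>R B (x (k+1)) + lam *\<^sub>R B (x k) + lam *\<^sub>R B p) (x (k+2) - p)
        \<ge> 2 * 0 - 0" for k
    proof -
      have eq: "x (k+1) - x (k+2) - 2 *\<^sub>R lam *\<^sub>R B (x (k+1)) + lam *\<^sub>R B (x k) + lam *\<^sub>R B p
          = lam *\<^sub>R (a k - - B p)"
        using a[of k] by (simp add: algebra_simps)
      have "inner (x (k+2) - p) (a k - - B p) \<ge> 0"
        using max aA[of k] pA unfolding maximally_monotone_def monotone_op_def by blast
      then show ?thesis
        unfolding eq using lam(1) by (simp add: inner_commute)
    qed
    moreover have "inner (lam *\<^sub>R B (x k) - lam *\<^sub>R B p) (x k - p) \<ge> 0" for k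
    proof -
      have "inner (x k - p) (B (x k) - B p) \<ge> 0"
        using mono by (simp add: monotone_op_def)
      then show ?thesis
        using lam(1) by (simp add: inner_commute flip: scaleR_diff_right)
    qed
    moreover have "norm (lam *\<^sub>R B (x (k+1)) - lam *\<^sub>R B (x k)) \<le> lam * L * norm (x (k+1) - x k)" for k
      using lipschitz_onD[OF lip, of "x (k+1)" "x k"] lam(1)
      by (simp add: dist_norm flip: scaleR_diff_right)
    ultimately show ?thesis
      using energy_descent[where y = x and b = "\<lambda>k. lam *\<^sub>R B (x k)" and phi = "\<lambda>_. 0" and p = p
            and c = "lam *\<^sub>R B p", OF _ _ _ _ L lam(2)]
      by simp
  qed
  then have d: "(\<lambda>k. x (k+1) - x k) \<longlonglongrightarrow> 0"
    using ne by auto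
  have d1: "(\<lambda>k. x (k+2) - x (k+1)) \<longlonglongrightarrow> 0"
    using LIMSEQ_ignore_initial_segment[OF d, of 1] by (simp add: add.commute)
  \<comment> \<open>Solving the iteration for the residual of the inclusion at
    \<open>x (k+2)\<close> leaves only increments of \<open>x\<close> and of \<open>B\<close>, all
    of which vanish.\<close>
  have eq: "a k + B (x (k+2)) = (B (x (k+2)) - B (x (k+1))) - (B (x (k+1)) - B (x k))
      - inverse lam *\<^sub>R (x (k+2) - x (k+1))" for k
  proof -
    have la: "lam *\<^sub>R a k = x (k+1) - x (k+2) - 2 *\<^sub>R (lam *\<^sub>R B (x (k+1))) + lam *\<^sub>R B (x k)"
      using a[of k] by (simp add: algebra_simps)
    have inv: "lam *\<^sub>R inverse lam *\<^sub>R v = v" for v :: 'h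
      using lam(1) by simp
    have "lam *\<^sub>R (a k + B (x (k+2))) = lam *\<^sub>R ((B (x (k+2)) - B (x (k+1))) - (B (x (k+1)) - B (x k))
      - inverse lam *\<^sub>R (x (k+2) - x (k+1)))"
      unfolding scaleR_add_right scaleR_diff_right la inv scaleR_2 by (simp only: algebra_simps)
    then show ?thesis
      using lam(1) by simp
  qed
  have "(\<lambda>k. a k + B (x (k+2))) \<longlonglongrightarrow> 0 - 0 - inverse lam *\<^sub>R 0"
    unfolding eq by (intro tendsto_diff tendsto_scaleR tendsto_const d1 lipschitz_diff_tendsto_zero[OF lip] d)
  moreover have "convergent (\<lambda>k. norm (x (k+2) - p))" if "p \<in> zer (\<lambda>x. A x + {B x})" for p
    using main[OF that] LIMSEQ_ignore_initial_segment[of "\<lambda>k. norm (x k - p)" _ 2]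
    unfolding convergent_def by blast
  ultimately have "\<exists>l\<in>zer (\<lambda>x. A x + {B x}). weakly_converges (\<lambda>k. x (k+2)) l"
    by (intro asymptotically_regular_imp_weakly_converges[OF max mono lip ne aA]) auto
  then show ?thesis
    using weakly_converges_offset by blast
qed

theorem rfb_weakly_converges:
  fixes A :: "'h::{real_inner,complete_space} \<Rightarrow> 'h set"
  assumes lam: "0 < lam" "lam * L < 1/2"
    and max: "maximally_monotone A" and mono: "monotone_op (\<lambda>x. {B x})"
    and lip: "L-lipschitz_on UNIV B"
    and ne: "zer (\<lambda>x. A x + {B x}) \<noteq> {}" and orbit: "rfb lam A B x"
  shows "\<exists>l\<in>zer (\<lambda>x. A x + {B x}). weakly_converges x l"
proof -
  define y where "y k = 2 *\<^sub>R x (k+1) - x k" for k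
  have "\<exists>a. a \<in> A (x (k+2)) \<and> x (k+1) - lam *\<^sub>R B (y k) = x (k+2) + lam *\<^sub>R a" for k
    using orbit by (auto simp: rfb_def resolvent_def y_def)
  then obtain a where aA: "\<And>k. a k \<in> A (x (k+2))"
    and a: "\<And>k. x (k+1) - lam *\<^sub>R B (y k) = x (k+2) + lam *\<^sub>R a k"
    by metis
  have la: "lam *\<^sub>R a k = x (k+1) - x (k+2) - lam *\<^sub>R B (y k)" for k
    using a[of k] by (simp add: algebra_simps)
  have monoA: "inner (lam *\<^sub>R (c - d)) (u - v) \<ge> 0" if "c \<in> A u" "d \<in> A v" for u v c d
  proof -
    have "inner (u - v) (c - d) \<ge> 0"
      using max that by (auto simp: maximally_monotone_def monotone_op_def)
    then show ?thesis
      using lam(1) by (simp add: inner_commute)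
  qed
  have L: "0 \<le> lam * L"
    using lam(1) lipschitz_on_nonneg[OF lip] by simp
  have main: "(\<lambda>k. y (k+1) - y k) \<longlonglongrightarrow> 0 \<and> convergent (\<lambda>k. norm (y k - p))"
    if p: "p \<in> zer (\<lambda>x. A x + {B x})" for p
  proof -
    have pA: "- B p \<in> A p"
      using p by (simp add: zer_sum_single_iff)
    \<comment> \<open>The gap in the monotonicity of \<open>A\<close> between the iterate and the
      solution; it is the telescoping price of reflecting \<open>a\<close> and
      \<open>x\<close>.\<close>
    define phi where "phi k = inner (lam *\<^sub>R (a k - - B p)) (x (k+2) - p)" for k
    have "inner (y (k+1) - y (k+2) - 2 *\<^sub>R lam *\<^sub>R B (y (k+1)) + lam *\<^sub>R B (y k) + lam *\<^sub>R B p) (y (k+2) - p)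
        \<ge> 2 * phi (k+1) - phi k" for k
    proof -
      \<comment> \<open>Twice the resolvent equation at \<open>k+1\<close> minus the one at
        \<open>k\<close>: the iterates combine into reflected points.\<close>
      have "2 *\<^sub>R (lam *\<^sub>R a (k+1)) - lam *\<^sub>R a k + lam *\<^sub>R B p =
          y (k+1) - y (k+2) - 2 *\<^sub>R lam *\<^sub>R B (y (k+1)) + lam *\<^sub>R B (y k) + lam *\<^sub>R B p"
        unfolding la y_def[of "k+2"] y_def[of "k+1"]
        by (simp add: scaleR_2 numeral_3_eq_3 algebra_simps)
      moreover have "2 *\<^sub>R (lam *\<^sub>R a (k+1)) - lam *\<^sub>R a k + lam *\<^sub>R B p =
          2 *\<^sub>R (lam *\<^sub>R (a (k+1) - - B p)) - lam *\<^sub>R (a k - - B p)"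
        by (simp add: scaleR_2 algebra_simps del: scaleR_scaleR)
      moreover have "y (k+2) - p = 2 *\<^sub>R (x (k+3) - p) - (x (k+2) - p)"
        by (simp add: y_def scaleR_2 numeral_3_eq_3 algebra_simps)
      moreover have "inner (lam *\<^sub>R (a (k+1) - - B p) - lam *\<^sub>R (a k - - B p))
          ((x (k+3) - p) - (x (k+2) - p)) \<ge> 0"
        using monoA[OF aA[of "k+1"] aA[of k]]
        by (simp add: algebra_simps numeral_3_eq_3)
      ultimately show ?thesis
        using inner_reflected[of "lam *\<^sub>R (a (k+1) - - B p)" "lam *\<^sub>R (a k - - B p)" "x (k+3) - p" "x (k+2) - p"]
        by (simp add: phi_def numeral_3_eq_3)
    qed
    moreover have "phi k \<ge> 0" for k
      unfolding phi_def by (rule monoA[OF aA pA])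
    moreover have "inner (lam *\<^sub>R B (y k) - lam *\<^sub>R B p) (y k - p) \<ge> 0" for k
    proof -
      have "inner (y k - p) (B (y k) - B p) \<ge> 0"
        using mono by (simp add: monotone_op_def)
      then show ?thesis
        using lam(1) by (simp add: inner_commute flip: scaleR_diff_right)
    qed
    moreover have "norm (lam *\<^sub>R B (y (k+1)) - lam *\<^sub>R B (y k)) \<le> lam * L * norm (y (k+1) - y k)" for k
      using lipschitz_onD[OF lip, of "y (k+1)" "y k"] lam(1)
      by (simp add: dist_norm flip: scaleR_diff_right)
    ultimately show ?thesis
      using energy_descent[where y = y and b = "\<lambda>k. lam *\<^sub>R B (y k)" and phi = phi and p = p
            and c = "lam *\<^sub>R B p", OF _ _ _ _ L lam(2)]
      by blast
  qed
  then have dy: "(\<lambda>k. y (k+1) - y k) \<longlonglongrightarrow> 0"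
    using ne by auto
  define e where "e k = x (k+1) - x k" for k
  have "(\<lambda>k. norm (e k)) \<longlonglongrightarrow> 0"
  proof (rule averaged_tendsto_zero)
    fix k
    \<comment> \<open>The reflection is inverted stably: each increment of \<open>x\<close> is an
      average of the previous one and an increment of \<open>y\<close>.\<close>
    have "2 *\<^sub>R e (Suc k) = e k + (y (k+1) - y k)"
      by (simp add: e_def y_def scaleR_2 algebra_simps)
    then have "2 * norm (e (Suc k)) = norm (e k + (y (k+1) - y k))"
      by (metis norm_scaleR abs_numeral)
    then show "norm (e (Suc k)) \<le> (norm (e k) + norm (y (k+1) - y k)) / 2"
      using norm_triangle_ineq[of "e k" "y (k+1) - y k"] by simp
  qed (use tendsto_norm_zero[OF dy] in auto)
  then have e: "e \<longlonglongrightarrow> 0"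
    by (rule tendsto_norm_zero_cancel)
  have e1: "(\<lambda>k. e (k+1)) \<longlonglongrightarrow> 0"
    using LIMSEQ_ignore_initial_segment[OF e, of 1] .
  \<comment> \<open>The iterate and the reflected point differ by a second difference, so
    convergence of the distances passes from \<open>y\<close> to \<open>x\<close>.\<close>
  have xy: "x (k+2) - y k = e (k+1) - e k" for k
    by (simp add: e_def y_def scaleR_2)
  have close: "(\<lambda>k. x (k+2) - y k) \<longlonglongrightarrow> 0"
    unfolding xy using tendsto_diff[OF e1 e] by simp
  have eq: "a k + B (x (k+2)) = (B (x (k+2)) - B (y k)) - inverse lam *\<^sub>R e (k+1)" for k
  proof -
    have "a k = inverse lam *\<^sub>R (x (k+1) - x (k+2) - lam *\<^sub>R B (y k))"
      using la[of k] lam(1) by (metis less_irrefl scaleR_scaleR scaleR_one left_inverse)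
    then show ?thesis
      using lam(1) by (simp add: e_def algebra_simps)
  qed
  have "(\<lambda>k. a k + B (x (k+2))) \<longlonglongrightarrow> 0 - inverse lam *\<^sub>R 0"
    unfolding eq
    by (intro tendsto_diff tendsto_scaleR tendsto_const e1 lipschitz_diff_tendsto_zero[OF lip] close)
  then have "\<exists>l\<in>zer (\<lambda>x. A x + {B x}). weakly_converges (\<lambda>k. x (k+2)) l"
    using main convergent_norm_diff_close[OF _ close]
    by (intro asymptotically_regular_imp_weakly_converges[OF max mono lip ne aA]) auto
  then show ?thesis
    using weakly_converges_offset by blast
qed

lemma certified_half_inverse_lipschitz:
  assumes "L > 0"
  shows "certified TYPE('h::{real_inner,complete_space}) frb L (1 / (2 * L))"
    and "certified TYPE('h) rfb L (1 / (2 * L))"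
proof -
  have "lam * L < 1/2" if "lam < 1 / (2 * L)" for lam
    using that assms by (simp add: field_simps)
  then show "certified TYPE('h) frb L (1 / (2 * L))" "certified TYPE('h) rfb L (1 / (2 * L))"
    unfolding certified_def using frb_weakly_converges rfb_weakly_converges by blast+
qed

subsection \<open>Rotations as multiplication by the imaginary unit\<close>

definition plane_complex :: "real^2 \<Rightarrow> complex" where
  "plane_complex w = Complex (w $ 1) (w $ 2)"

lemma plane_complex_rot [simp]: "plane_complex (rot w) = \<i> * plane_complex w"
  by (simp add: plane_complex_def rot_def complex_eq_iff)

lemma plane_complex_linear [simp]:
  "plane_complex (u + v) = plane_complex u + plane_complex v"
  "plane_complex (u - v) = plane_complex u - plane_complex v"
  "plane_complex (r *\<^sub>R u) = of_real r * plane_complex u"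
  "plane_complex 0 = 0"
  by (simp_all add: plane_complex_def complex_eq_iff)

lemma norm_plane_complex [simp]: "norm (plane_complex w) = norm w"
  by (simp add: plane_complex_def cmod_def norm_vec_def L2_set_def sum_2)

lemma plane_complex_eq_iff [simp]: "plane_complex u = plane_complex v \<longleftrightarrow> u = v"
  by (simp add: plane_complex_def vec_eq_iff forall_2)

lemma plane_complex_surj: "plane_complex (vector [Re z, Im z]) = z"
  by (simp add: plane_complex_def)

lemma inner_rot [simp]: "inner w (rot w) = 0"
  by (simp add: inner_vec_def sum_2 rot_def)

lemma rot_diff: "rot u - rot v = rot (u - v)"
  by (simp add: rot_def vec_eq_iff forall_2)

lemma norm_rot [simp]: "norm (rot w) = norm w"
  using norm_plane_complex[of "rot w"] norm_plane_complex[of w]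
  by (simp add: norm_mult del: norm_plane_complex)

lemma scaled_rot_monotone: "monotone_op (\<lambda>w. {L *\<^sub>R rot w})"
  by (simp add: monotone_op_def rot_diff flip: scaleR_diff_right)

lemma scaled_rot_lipschitz: "L \<ge> 0 \<Longrightarrow> L-lipschitz_on UNIV (\<lambda>w. L *\<^sub>R rot w)"
  by (rule lipschitz_onI) (simp_all add: dist_norm rot_diff flip: scaleR_diff_right)

lemma scaled_rot_zer:
  assumes "L \<noteq> 0"
  shows "zer (\<lambda>w. {L *\<^sub>R rot w} + {L *\<^sub>R rot w}) = {0}"
proof -
  have "0 = L *\<^sub>R rot w + L *\<^sub>R rot w \<longleftrightarrow> w = 0" for w
  proof -
    have "0 = L *\<^sub>R rot w + L *\<^sub>R rot w \<longleftrightarrow> (2 * L) *\<^sub>R rot w = 0"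
      by (simp only: mult_2 scaleR_add_left eq_commute)
    also have "\<dots> \<longleftrightarrow> w = 0"
      using assms norm_rot[of w] by (metis mult_eq_0_iff norm_eq_zero scaleR_eq_0_iff zero_neq_numeral)
    finally show ?thesis .
  qed
  then show ?thesis
    by (auto simp: zer_def set_plus_def)
qed

lemma one_plus_imag_nonzero: "1 + \<i> * complex_of_real t \<noteq> 0"
  by (simp add: complex_eq_iff)

lemma resolvent_scaled_rot_iff:
  "p \<in> resolvent lam (\<lambda>w. {L *\<^sub>R rot w}) z \<longleftrightarrow>
    (1 + \<i> * of_real (lam * L)) * plane_complex p = plane_complex z"
proof -
  have "p \<in> resolvent lam (\<lambda>w. {L *\<^sub>R rot w}) z \<longleftrightarrow>
      plane_complex z = plane_complex (p + lam *\<^sub>R L *\<^sub>R rot p)"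
    by (simp only: resolvent_def plane_complex_eq_iff) simp
  also have "plane_complex (p + lam *\<^sub>R L *\<^sub>R rot p) = (1 + \<i> * of_real (lam * L)) * plane_complex p"
    by (simp add: algebra_simps)
  finally show ?thesis
    by metis
qed

text \<open>The resolvent is division by 1 + i \<open>lam\<close> \<open>L\<close>, whose real part
  is 1, so it never degenerates.\<close>

lemma resolvent_scaled_rot_ex1: "\<exists>!p. p \<in> resolvent lam (\<lambda>w. {L *\<^sub>R rot w}) z"
proof
  define c where "c = plane_complex z / (1 + \<i> * of_real (lam * L))"
  have "(1 + \<i> * of_real (lam * L)) * c = plane_complex z"
    using one_plus_imag_nonzero[of "lam * L"] by (simp add: c_def)
  then show "vector [Re c, Im c] \<in> resolvent lam (\<lambda>w. {L *\<^sub>R rot w}) z"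
    by (simp only: resolvent_scaled_rot_iff plane_complex_surj)
  fix p assume "p \<in> resolvent lam (\<lambda>w. {L *\<^sub>R rot w}) z"
  then have "plane_complex p = plane_complex (vector [Re c, Im c])"
    using one_plus_imag_nonzero[of "lam * L"]
    by (simp only: resolvent_scaled_rot_iff plane_complex_surj c_def) (simp add: nonzero_eq_divide_eq mult.commute)
  then show "p = vector [Re c, Im c]"
    by simp
qed

section \<open>Growth of the scalar recurrence\<close>

definition rotation_recurrence :: "real \<Rightarrow> (nat \<Rightarrow> complex) \<Rightarrow> bool" where
  "rotation_recurrence t z \<longleftrightarrow>
    (\<forall>k. (1 + \<i> * of_real t) * z (k+2) = (1 - 2 * \<i> * of_real t) * z (k+1) + \<i> * of_real t * z k)"

text \<open>For linear forward operators the two methods coincide.\<close>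

lemma frb_scaled_rot_iff:
  "frb lam (\<lambda>w. {L *\<^sub>R rot w}) (\<lambda>w. L *\<^sub>R rot w) x \<longleftrightarrow>
    rotation_recurrence (lam * L) (\<lambda>k. plane_complex (x k))"
  unfolding frb_def rotation_recurrence_def resolvent_scaled_rot_iff
  by (simp add: algebra_simps)

lemma rfb_scaled_rot_iff:
  "rfb lam (\<lambda>w. {L *\<^sub>R rot w}) (\<lambda>w. L *\<^sub>R rot w) x \<longleftrightarrow>
    rotation_recurrence (lam * L) (\<lambda>k. plane_complex (x k))"
  unfolding rfb_def rotation_recurrence_def resolvent_scaled_rot_iff
  by (simp add: algebra_simps)

text \<open>The combination \<open>z (k+1) - r2 * z k\<close> is geometric with ratio
  \<open>r1\<close>, and likewise with the roots exchanged. Eliminating \<open>z (k+1)\<close> gives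
  the closed form; \<open>init\<close> says that the dominant root has a nonzero coefficient, so
  \<open>z k / r1 ^ k\<close> has a nonzero limit.\<close>

lemma two_term_recurrence_bigtheta:
  fixes z :: "nat \<Rightarrow> 'a::real_normed_field"
  assumes rec: "\<And>k. z (k+2) = (r1 + r2) * z (k+1) - r1 * r2 * z k"
    and less: "norm r2 < norm r1" and init: "z 1 \<noteq> r2 * z 0"
  shows "(\<lambda>k. norm (z k)) \<in> \<Theta>(\<lambda>k. norm r1 ^ k)"
proof -
  define w v where "w = z 1 - r2 * z 0" and "v = z 1 - r1 * z 0"
  have ne: "r1 \<noteq> 0" "r1 \<noteq> r2"
    using less by auto
  have "z (k+1) - r2 * z k = r1 ^ k * w \<and> z (k+1) - r1 * z k = r2 ^ k * v" for k
  proof (induction k)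
    case (Suc k)
    have "z (Suc k + 1) - r2 * z (Suc k) = r1 * (z (k+1) - r2 * z k)"
      and "z (Suc k + 1) - r1 * z (Suc k) = r2 * (z (k+1) - r1 * z k)"
      using rec[of k] by (simp_all add: algebra_simps)
    with Suc show ?case
      by simp
  qed (simp add: w_def v_def)
  then have "(r1 - r2) * z k = r1 ^ k * w - r2 ^ k * v" for k
    by (metis (no_types, opaque_lifting) add_diff_cancel_left' diff_diff_eq2 left_diff_distrib diff_add_cancel)
  then have "(r1 - r2) * z k = r1 ^ k * (w - (r2 / r1) ^ k * v)" for k
    using ne by (simp add: right_diff_distrib power_divide)
  then have "z k / r1 ^ k = (w - (r2 / r1) ^ k * v) / (r1 - r2)" for k
    using ne by (simp add: frac_eq_eq mult.commute)
  moreover have "(\<lambda>k. (w - (r2 / r1) ^ k * v) / (r1 - r2)) \<longlonglongrightarrow> (w - 0 * v) / (r1 - r2)"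
    using less ne by (intro tendsto_intros LIMSEQ_power_zero) (auto simp: norm_divide)
  ultimately have "(\<lambda>k. norm (z k / r1 ^ k)) \<longlonglongrightarrow> norm (w / (r1 - r2))"
    using tendsto_norm by fastforce
  then have "(\<lambda>k. norm (z k) / norm r1 ^ k) \<longlonglongrightarrow> norm (w / (r1 - r2))"
    by (simp add: norm_divide norm_power)
  moreover have "norm (w / (r1 - r2)) \<noteq> 0"
    using init ne by (simp add: w_def)
  ultimately show ?thesis
    using ne by (intro bigthetaI_tendsto) auto
qed

text \<open>The discriminant of the characteristic polynomial is \<open>1 - 8 t\<^sup>2\<close>, whose square root is
  purely imaginary in the range considered.\<close>

lemma rotation_characteristic_roots:
  assumes "t \<ge> 1/2"
  obtains r1 r2 :: complex where
    "(1 + \<i> * of_real t) * (r1 + r2) = 1 - 2 * \<i> * of_real t"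
    "(1 + \<i> * of_real t) * (r1 * r2) = - (\<i> * of_real t)"
    "norm r2 < norm r1" "1 \<le> norm r1" "t > 1/2 \<Longrightarrow> 1 < norm r1"
proof -
  define s where "s = sqrt (8 * t\<^sup>2 - 1)"
  have t2: "t\<^sup>2 \<ge> 1/4" "t > 1/2 \<Longrightarrow> t\<^sup>2 > 1/4"
    using assms power_mono[of "1/2" t 2] power_strict_mono[of "1/2" t 2] by (auto simp: power2_eq_square)
  have s2: "s\<^sup>2 = 8 * t\<^sup>2 - 1" and s1: "s \<ge> 1"
    using t2 by (auto simp: s_def intro!: real_le_rsqrt)
  define D where "D = 1 + \<i> * complex_of_real t"
  have D: "D \<noteq> 0"
    unfolding D_def by (rule one_plus_imag_nonzero)
  \<comment> \<open>The quadratic formula, with \<open>s\<close> and \<open>- s\<close> selecting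
    the two roots.\<close>
  define r where "r \<sigma> = Complex 1 (- (2 * t + \<sigma>)) / (2 * D)" for \<sigma>
  have sum: "D * (r s + r (- s)) = 1 - 2 * \<i> * of_real t"
    using D by (simp add: r_def add_divide_distrib[symmetric]) (simp add: complex_eq_iff)
  have "Complex 1 (- (2 * t + s)) * Complex 1 (- (2 * t - s)) = 4 * D * (- (\<i> * of_real t))"
    using s2 by (simp add: complex_eq_iff D_def power2_eq_square algebra_simps)
  then have prod: "D * (r s * r (- s)) = - (\<i> * of_real t)"
    using D by (simp add: r_def)
  have norm_r: "(norm (r \<sigma>))\<^sup>2 = (1 + (2 * t + \<sigma>)\<^sup>2) / (4 * (1 + t\<^sup>2))" for \<sigma>
    by (simp add: r_def D_def norm_divide norm_mult power_divide power_mult_distrib cmod_power2)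
      (simp add: power2_eq_square algebra_simps)
  have pos: "4 * (1 + t\<^sup>2) > 0"
    by (simp add: add_pos_nonneg)
  have "(norm (r (- s)))\<^sup>2 < (norm (r s))\<^sup>2"
  proof -
    have "(2 * t + - s)\<^sup>2 < (2 * t + s)\<^sup>2"
      using s1 assms by (simp add: power2_eq_square algebra_simps)
    then show ?thesis
      unfolding norm_r using pos by (intro divide_strict_right_mono) auto
  qed
  then have less: "norm (r (- s)) < norm (r s)"
    by (rule power_less_imp_less_base) simp
  have expand: "1 + (2 * t + s)\<^sup>2 = 12 * t\<^sup>2 + 4 * (t * s)"
    using s2 by (simp add: power2_eq_square algebra_simps)
  have ts: "t * s \<ge> t"
    using s1 assms by simp
  \<comment> \<open>After cancellation this asks for 8 t^2 + 4 t s \<ge> 4. Each summand is at least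
    2, with equality for both at t = 1/2.\<close>
  have "4 * (1 + t\<^sup>2) \<le> 12 * t\<^sup>2 + 4 * (t * s)"
    using t2(1) order_trans[OF assms ts] by (simp add: distrib_left)
  then have "1\<^sup>2 \<le> (norm (r s))\<^sup>2"
    unfolding norm_r expand using pos by (simp add: le_divide_eq)
  then have ge: "1 \<le> norm (r s)"
    by (rule power2_le_imp_le) simp
  have gt: "1 < norm (r s)" if "t > 1/2"
  proof -
    have "4 * (1 + t\<^sup>2) < 12 * t\<^sup>2 + 4 * (t * s)"
      using t2(2)[OF that] less_le_trans[OF that ts] by (simp add: distrib_left)
    then have "1\<^sup>2 < (norm (r s))\<^sup>2"
      unfolding norm_r expand using pos by (simp add: less_divide_eq)
    then show ?thesis
      by (rule power_less_imp_less_base) simp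
  qed
  show thesis
    using that[of "r s" "r (- s)"] sum prod less ge gt by (simp add: D_def)
qed

lemma rotation_recurrence_growth:
  assumes roots: "(1 + \<i> * of_real t) * (r1 + r2) = 1 - 2 * \<i> * of_real t"
      "(1 + \<i> * of_real t) * (r1 * r2) = - (\<i> * of_real t)"
    and less: "norm r2 < norm r1" and ge: "1 \<le> norm r1"
    and rec: "rotation_recurrence t (\<lambda>k. plane_complex (x k))"
    and init: "plane_complex (x 1) \<noteq> r2 * plane_complex (x 0)"
  shows "(\<lambda>k. norm (x k)) \<in> \<Theta>(\<lambda>k. norm r1 ^ k)" "\<not> x \<longlonglongrightarrow> 0"
proof -
  have "plane_complex (x (k+2)) = (r1 + r2) * plane_complex (x (k+1)) - r1 * r2 * plane_complex (x k)" for k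
  proof -
    have "(1 + \<i> * of_real t) * plane_complex (x (k+2)) =
        (1 + \<i> * of_real t) * (r1 + r2) * plane_complex (x (k+1)) - (1 + \<i> * of_real t) * (r1 * r2) * plane_complex (x k)"
      using rec unfolding roots rotation_recurrence_def by simp
    also have "\<dots> = (1 + \<i> * of_real t) * ((r1 + r2) * plane_complex (x (k+1)) - r1 * r2 * plane_complex (x k))"
      by (simp only: algebra_simps)
    finally show ?thesis
      using one_plus_imag_nonzero[of t] by (simp only: mult_cancel_left) simp
  qed
  from two_term_recurrence_bigtheta[OF this less init]
  show theta: "(\<lambda>k. norm (x k)) \<in> \<Theta>(\<lambda>k. norm r1 ^ k)"
    by simp
  show "\<not> x \<longlonglongrightarrow> 0"
  proof
    assume "x \<longlonglongrightarrow> 0"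
    then have lim: "(\<lambda>k. norm (x k)) \<longlonglongrightarrow> 0"
      by (rule tendsto_norm_zero)
    from theta have "(\<lambda>k. norm r1 ^ k) \<in> O(\<lambda>k. norm (x k))"
      by (simp add: bigtheta_def bigomega_iff_bigo)
    then obtain c where c: "c > 0" "\<forall>\<^sub>F k in sequentially. norm (norm r1 ^ k) \<le> c * norm (norm (x k))"
      by (rule landau_o.bigE)
    \<comment> \<open>The lower growth bound keeps the orbit away from zero even when
      \<open>norm r1\<close> is only 1, as at the threshold.\<close>
    have "\<forall>\<^sub>F k in sequentially. 1 \<le> c * norm (x k)"
      using c(2)
    proof eventually_elim
      case (elim k)
      then show ?case
        using one_le_power[OF ge, of k] by simp
    qed
    moreover have "(\<lambda>k. c * norm (x k)) \<longlonglongrightarrow> c * 0"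
      by (intro tendsto_mult_left lim)
    ultimately have "1 \<le> c * 0"
      by (intro tendsto_lowerbound) auto
    then show False
      by simp
  qed
qed

lemma generic_rotation_divergence:
  assumes "t \<ge> 1/2"
    and orbit: "\<And>x. orbit x \<longleftrightarrow> rotation_recurrence t (\<lambda>k. plane_complex (x k))"
  shows "generic (\<lambda>(x0, xm1). \<forall>x. x 0 = xm1 \<and> x 1 = x0 \<and> orbit x \<longrightarrow>
           \<not> x \<longlonglongrightarrow> 0 \<and> (t > 1/2 \<longrightarrow> diverges_geometrically x))"
proof -
  obtain r1 r2 where roots: "(1 + \<i> * of_real t) * (r1 + r2) = 1 - 2 * \<i> * of_real t"
      "(1 + \<i> * of_real t) * (r1 * r2) = - (\<i> * of_real t)" "norm r2 < norm r1" "1 \<le> norm r1"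
    and gt: "t > 1/2 \<Longrightarrow> 1 < norm r1"
    using rotation_characteristic_roots[OF assms(1)] by blast
  \<comment> \<open>Initial pairs \<open>(x 1, x 0)\<close> on the pure mode of the smaller root
    \<open>r2\<close>. The condition is complex linear, hence cuts out a real subspace.\<close>
  define S where "S = {p. plane_complex (fst p) = r2 * plane_complex (snd p)}"
  have "subspace S"
    by (auto simp: subspace_def S_def distrib_left)
  \<comment> \<open>With second component zero, membership would force the first to vanish; hence
    \<open>S\<close> is proper.\<close>
  moreover have "(vector [Re 1, Im 1], 0) \<notin> S"
    unfolding S_def by (simp del: one_complex.sel add: plane_complex_surj)
  moreover have "\<not> x \<longlonglongrightarrow> 0 \<and> (t > 1/2 \<longrightarrow> diverges_geometrically x)"
    if "(x 1, x 0) \<notin> S" "orbit x" for x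
    using rotation_recurrence_growth[OF roots, of x] that gt
    by (auto simp: S_def orbit diverges_geometrically_def)
  ultimately show ?thesis
    unfolding generic_def by (intro exI[of _ S]) auto
qed

section \<open>Sharpness of the constant\<close>

lemma weakly_converges_vec_imp_tendsto:
  fixes x :: "nat \<Rightarrow> real^'n"
  assumes "weakly_converges x l"
  shows "x \<longlonglongrightarrow> l"
proof (rule vec_tendstoI)
  fix i
  have "(\<lambda>k. inner (x k) (axis i 1)) \<longlonglongrightarrow> inner l (axis i 1)"
    using assms by (simp add: weakly_converges_def)
  then show "(\<lambda>k. x k $ i) \<longlonglongrightarrow> l $ i"
    by (simp add: inner_axis)
qed

lemma not_certified_beyond_half_inverse_lipschitz:
  assumes L: "L > 0" and c: "c > 1 / (2 * L)"
    and iteration: "\<And>lam x. iteration lam (\<lambda>w. {L *\<^sub>R rot w}) (\<lambda>w. L *\<^sub>R rot w) x \<longleftrightarrow>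
      rotation_recurrence (lam * L) (\<lambda>k. plane_complex (x k))"
  shows "\<not> certified TYPE(real^2) iteration L c"
proof
  assume cert: "certified TYPE(real^2) iteration L c"
  \<comment> \<open>The critical step size is itself admissible for every larger \<open>c\<close>,
    and failure to converge there is enough.\<close>
  define lam where "lam = 1 / (2 * L)"
  have lam: "0 < lam" "lam < c" "lam * L = 1/2"
    using L c by (simp_all add: lam_def)
  obtain r1 r2 where roots: "(1 + \<i> * of_real (1/2)) * (r1 + r2) = 1 - 2 * \<i> * of_real (1/2)"
      "(1 + \<i> * of_real (1/2)) * (r1 * r2) = - (\<i> * of_real (1/2))" "norm r2 < norm r1" "1 \<le> norm r1"
    using rotation_characteristic_roots[of "1/2"] by blast
  \<comment> \<open>The pure mode of the dominant root: an explicit orbit, needed because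
    \<open>certified\<close> only speaks about given orbits.\<close>
  define x :: "nat \<Rightarrow> real^2" where "x k = vector [Re (r1 ^ k), Im (r1 ^ k)]" for k
  have x: "plane_complex (x k) = r1 ^ k" for k
    by (simp add: x_def plane_complex_surj)
  have char: "(1 + \<i> * of_real (1/2)) * (r1 * r1) = (1 - 2 * \<i> * of_real (1/2)) * r1 + \<i> * of_real (1/2)"
  proof -
    have "(1 + \<i> * of_real (1/2)) * (r1 * r1) =
        (1 + \<i> * of_real (1/2)) * (r1 + r2) * r1 - (1 + \<i> * of_real (1/2)) * (r1 * r2)"
      by (simp only: algebra_simps)
    then show ?thesis
      unfolding roots by simp
  qed
  have rec: "rotation_recurrence (1/2) (\<lambda>k. plane_complex (x k))"
    unfolding rotation_recurrence_def x
  proof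
    fix k
    have "(1 + \<i> * of_real (1/2)) * r1 ^ (k+2) = (1 + \<i> * of_real (1/2)) * (r1 * r1) * r1 ^ k"
      by (simp add: power2_eq_square power_add)
    also have "\<dots> = (1 - 2 * \<i> * of_real (1/2)) * r1 ^ (k+1) + \<i> * of_real (1/2) * r1 ^ k"
      unfolding char by (simp only: algebra_simps power_add power_one_right)
    finally show "(1 + \<i> * of_real (1/2)) * r1 ^ (k+2) =
        (1 - 2 * \<i> * of_real (1/2)) * r1 ^ (k+1) + \<i> * of_real (1/2) * r1 ^ k" .
  qed
  have lip: "L-lipschitz_on UNIV (\<lambda>w. L *\<^sub>R rot w)"
    using L by (simp add: scaled_rot_lipschitz)
  have max: "maximally_monotone (\<lambda>w. {L *\<^sub>R rot w})"
    by (intro continuous_monotone_imp_maximally_monotone scaled_rot_monotone lipschitz_on_continuous_on[OF lip])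
  have zer: "zer (\<lambda>w. {L *\<^sub>R rot w} + {L *\<^sub>R rot w}) = {0}"
    using L by (simp add: scaled_rot_zer)
  have "iteration lam (\<lambda>w. {L *\<^sub>R rot w}) (\<lambda>w. L *\<^sub>R rot w) x"
    unfolding iteration lam(3) by (rule rec)
  with cert[unfolded certified_def, rule_format, of lam "\<lambda>w. {L *\<^sub>R rot w}" "\<lambda>w. L *\<^sub>R rot w" x]
  have "weakly_converges x 0"
    using lam max scaled_rot_monotone lip by (simp add: zer)
  then have "x \<longlonglongrightarrow> 0"
    by (rule weakly_converges_vec_imp_tendsto)
  moreover have "plane_complex (x 1) \<noteq> r2 * plane_complex (x 0)"
    unfolding x using roots(3) by auto
  ultimately show False
    using rotation_recurrence_growth(2)[OF roots rec] by blast
qed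

theorem theorem1:
  fixes L :: real and A :: "real^2 \<Rightarrow> (real^2) set" and B :: "real^2 \<Rightarrow> real^2"
  assumes "L > 0"
    and "A = (\<lambda>w. {L *\<^sub>R rot w})"
    and "B = (\<lambda>w. L *\<^sub>R rot w)"
  shows "maximally_monotone A \<and> monotone_op (\<lambda>w. {B w}) \<and> L-lipschitz_on UNIV B
    \<and> zer (\<lambda>w. A w + {B w}) = {0}
    \<and> (\<forall>lam>0. \<forall>z. \<exists>!p. p \<in> resolvent lam A z)
    \<and> (\<forall>lam. lam \<ge> 1 / (2 * L) \<longrightarrow>
         generic (\<lambda>(x0, xm1). \<forall>x. x 0 = xm1 \<and> x 1 = x0 \<and> frb lam A B x \<longrightarrow>
           \<not> x \<longlonglongrightarrow> 0 \<and> (lam > 1 / (2 * L) \<longrightarrow> diverges_geometrically x))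
       \<and> generic (\<lambda>(x0, xm1). \<forall>x. x 0 = xm1 \<and> x 1 = x0 \<and> rfb lam A B x \<longrightarrow>
           \<not> x \<longlonglongrightarrow> 0 \<and> (lam > 1 / (2 * L) \<longrightarrow> diverges_geometrically x)))
    \<and> certified TYPE('h::{real_inner,complete_space}) frb L (1 / (2 * L))
    \<and> certified TYPE('h) rfb L (1 / (2 * L))
    \<and> (\<forall>c. c > 1 / (2 * L) \<longrightarrow>
         \<not> certified TYPE(real^2) frb L c \<and> \<not> certified TYPE(real^2) rfb L c)"
proof -
  have lip: "L-lipschitz_on UNIV B"
    using assms by (simp add: scaled_rot_lipschitz)
  have mono: "monotone_op (\<lambda>w. {B w})"
    unfolding assms(3) by (rule scaled_rot_monotone)
  have "maximally_monotone A"
    using continuous_monotone_imp_maximally_monotone[OF lipschitz_on_continuous_on[OF lip] mono]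
    by (simp add: assms(2,3))
  moreover have "zer (\<lambda>w. A w + {B w}) = {0}"
    using assms by (simp add: scaled_rot_zer)
  moreover have "\<forall>lam>0. \<forall>z. \<exists>!p. p \<in> resolvent lam A z"
    unfolding assms(2) by (intro allI impI resolvent_scaled_rot_ex1)
  moreover have "generic (\<lambda>(x0, xm1). \<forall>x. x 0 = xm1 \<and> x 1 = x0 \<and> frb lam A B x \<longrightarrow>
           \<not> x \<longlonglongrightarrow> 0 \<and> (lam > 1 / (2 * L) \<longrightarrow> diverges_geometrically x))
       \<and> generic (\<lambda>(x0, xm1). \<forall>x. x 0 = xm1 \<and> x 1 = x0 \<and> rfb lam A B x \<longrightarrow>
           \<not> x \<longlonglongrightarrow> 0 \<and> (lam > 1 / (2 * L) \<longrightarrow> diverges_geometrically x))"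
    if "lam \<ge> 1 / (2 * L)" for lam
  proof -
    have t: "lam * L \<ge> 1/2" and iff: "lam > 1 / (2 * L) \<longleftrightarrow> lam * L > 1/2"
      using that assms(1) by (simp_all add: field_simps)
    show ?thesis
      unfolding iff assms(2,3)
      by (intro conjI generic_rotation_divergence[OF t] frb_scaled_rot_iff rfb_scaled_rot_iff)
  qed
  moreover have "\<not> certified TYPE(real^2) frb L c \<and> \<not> certified TYPE(real^2) rfb L c"
    if "c > 1 / (2 * L)" for c
    using not_certified_beyond_half_inverse_lipschitz[OF assms(1) that] frb_scaled_rot_iff rfb_scaled_rot_iff
    by blast
  ultimately show ?thesis
    using lip mono certified_half_inverse_lipschitz[OF assms(1)] by blast
qed

end
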